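(* For every integer $n\ge 0$, the associated Hermite polynomial $H_n(x;c)$ satisfies $$H_n(x;c)=\sum_{M} wt(M),$$ where the sum runs over all incomplete matchings $M$ of $[n]$ and $wt(M)$ is the product of the following weights: each fixed point of $M$ has weight $x$; each edge of $M$ that nests no fixed points and no edges and has no left crossings has weight $-c$; every other edge of $M$ has weight $-1$.
   Context: $c$ and $x$ are indeterminates. The associated Hermite polynomials are defined by $H_0(x;c)=1$, $H_m(x;c)=0$ for $m<0$, and $H_{n+1}(x;c)=xH_n(x;c)-(n-1+c)H_{n-1}(x;c)$ for $n\ge 0$. Write $[n]=\{1,\dots,n\}$. An incomplete matching of $[n]$ is a partition of $[n]$ into blocks of size $1$ (fixed points) and blocks of size $2$ (edges). Write an edge as $(a,b)$ with $a<b$. The edge $(a,b)$ nests the vertex $v$ if $a<v<b$, and nests the edge $(a',b')$ if $a<a'<b'<b$. The edge $(a,b)$ has a left crossing if there is an edge $(a',b')$ with $a'<a<b'<b$. *)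

theory Defs
  imports "HOL-Library.Disjoint_Sets" "HOL-Computational_Algebra.Polynomial"
begin

(* The two indeterminates of R[c][x]: the inner polynomial layer is in c, the outer one in x. *)

definition indet_x :: "'a::comm_ring_1 poly poly" where
  "indet_x = [:0, 1:]"

definition indet_c :: "'a::comm_ring_1 poly poly" where
  "indet_c = [:[:0, 1:]:]"

(* The index is an integer, so that the convention H_m = 0 for m < 0 is literal.
   The third branch is the recurrence with n + 1 = m. *)

function assoc_hermite :: "int \<Rightarrow> 'a::comm_ring_1 \<Rightarrow> 'a \<Rightarrow> 'a" where
  "assoc_hermite m x c =
     (if m < 0 then 0 else if m = 0 then 1
      else x * assoc_hermite (m - 1) x c - (of_int (m - 2) + c) * assoc_hermite (m - 2) x c)"
  by pat_completeness auto
termination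
  by (relation "measure (\<lambda>(m, x, c). nat m)") auto

declare assoc_hermite.simps [simp del]

lemma assoc_hermite_neg: "m < 0 \<Longrightarrow> assoc_hermite m x c = 0"
  by (subst assoc_hermite.simps) simp

lemma assoc_hermite_0: "assoc_hermite 0 x c = 1"
  by (subst assoc_hermite.simps) simp

lemma assoc_hermite_rec:
  assumes "n \<ge> 0"
  shows "assoc_hermite (n + 1) x c =
         x * assoc_hermite n x c - (of_int (n - 1) + c) * assoc_hermite (n - 1) x c"
  using assms by (subst assoc_hermite.simps) simp

definition incomplete_matchings :: "nat \<Rightarrow> nat set set set" where
  "incomplete_matchings n = {M. partition_on {1..n} M \<and> (\<forall>B\<in>M. card B = 1 \<or> card B = 2)}"

lemma finite_incomplete_matchings: "finite (incomplete_matchings n)"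
  by (rule finite_subset [of _ "Pow (Pow {1..n})"])
     (auto simp: incomplete_matchings_def partition_on_def)

definition fixed_points :: "nat set set \<Rightarrow> nat set" where
  "fixed_points M = {v. {v} \<in> M}"

definition edges :: "nat set set \<Rightarrow> (nat \<times> nat) set" where
  "edges M = {(a, b). a < b \<and> {a, b} \<in> M}"

definition nests_vertex :: "nat \<times> nat \<Rightarrow> nat \<Rightarrow> bool" where
  "nests_vertex e v \<longleftrightarrow> fst e < v \<and> v < snd e"

definition nests_edge :: "nat \<times> nat \<Rightarrow> nat \<times> nat \<Rightarrow> bool" where
  "nests_edge e e' \<longleftrightarrow> fst e < fst e' \<and> fst e' < snd e' \<and> snd e' < snd e"

definition has_left_crossing :: "nat set set \<Rightarrow> nat \<times> nat \<Rightarrow> bool" where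
  "has_left_crossing M e \<longleftrightarrow>
     (\<exists>e'\<in>edges M. fst e' < fst e \<and> fst e < snd e' \<and> snd e' < snd e)"

definition edge_weight :: "'a::comm_ring_1 \<Rightarrow> nat set set \<Rightarrow> nat \<times> nat \<Rightarrow> 'a" where
  "edge_weight c M e =
     (if (\<forall>v\<in>fixed_points M. \<not> nests_vertex e v) \<and> (\<forall>e'\<in>edges M. \<not> nests_edge e e')
         \<and> \<not> has_left_crossing M e
      then - c else - 1)"

definition wt :: "'a::comm_ring_1 \<Rightarrow> 'a \<Rightarrow> nat set set \<Rightarrow> 'a" where
  "wt x c M = (\<Prod>v\<in>fixed_points M. x) * (\<Prod>e\<in>edges M. edge_weight c M e)"

lemma finite_fixed_points_edges:
  assumes "M \<in> incomplete_matchings n"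
  shows "finite (fixed_points M)" and "finite (edges M)"
proof -
  have *: "B \<subseteq> {1..n}" if "B \<in> M" for B
    using assms that by (auto simp: incomplete_matchings_def partition_on_def)
  have "fixed_points M \<subseteq> {1..n}"
    using * by (fastforce simp: fixed_points_def)
  then show "finite (fixed_points M)"
    by (rule finite_subset) simp
  have "edges M \<subseteq> {1..n} \<times> {1..n}"
    using * by (fastforce simp: edges_def)
  then show "finite (edges M)"
    by (rule finite_subset) simp
qed

end

theory Submission
  imports Defs
begin

text \<open>
  Remove the largest vertex together with its partner. Since it lies to the right of everything,
  its block neither is nested by another edge nor is a left crossing of one, so the remaining
  weights do not change. If the largest vertex is matched with \<open>a\<close>, every vertex between them is a
  fixed point, or belongs to a nested edge, or is the right end of a left crossing; so the edge has
  weight \<open>-c\<close> exactly when \<open>a\<close> is the second largest vertex. Among the \<open>n\<close> choices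
  of \<open>a\<close> in a vertex set of size \<open>n + 1\<close>, this gives the factor \<open>-(n - 1 + c)\<close>. Working
  with arbitrary finite vertex sets of naturals avoids relabelling.
\<close>

section \<open>Matchings of an arbitrary vertex set and the roles of a vertex\<close>

definition matchings_on :: "nat set \<Rightarrow> nat set set set" where
  "matchings_on S = {M. partition_on S M \<and> (\<forall>B\<in>M. card B = 1 \<or> card B = 2)}"

lemma matchings_on_atLeastAtMost: "matchings_on {1..n} = incomplete_matchings n"
  by (simp add: matchings_on_def incomplete_matchings_def)

lemma finite_matchings_on: "finite S \<Longrightarrow> finite (matchings_on S)"
  by (rule finite_subset [of _ "Pow (Pow S)"]) (auto simp: matchings_on_def partition_on_def)

lemma matchings_on_subset: "M \<in> matchings_on S \<Longrightarrow> B \<in> M \<Longrightarrow> B \<subseteq> S"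
  by (auto simp: matchings_on_def partition_on_def)

lemma matchings_on_empty: "matchings_on {} = {{}}"
  by (auto simp: matchings_on_def partition_on_empty)

lemma edgesD: "M \<in> matchings_on S \<Longrightarrow> (a, b) \<in> edges M \<Longrightarrow> a \<in> S \<and> b \<in> S \<and> a < b"
  using matchings_on_subset by (fastforce simp: edges_def)

lemma fixed_pointsD: "M \<in> matchings_on S \<Longrightarrow> v \<in> fixed_points M \<Longrightarrow> v \<in> S"
  using matchings_on_subset by (fastforce simp: fixed_points_def)

lemma finite_fixed_points: "finite S \<Longrightarrow> M \<in> matchings_on S \<Longrightarrow> finite (fixed_points M)"
  by (rule finite_subset [of _ S]) (auto dest: fixed_pointsD)

lemma finite_edges: "finite S \<Longrightarrow> M \<in> matchings_on S \<Longrightarrow> finite (edges M)"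
  by (rule finite_subset [of _ "S \<times> S"]) (auto dest: edgesD)

text \<open>A block of size two is oriented by comparing \<open>v\<close> with its partner, since
  nesting and crossing depend on whether \<open>v\<close> is the right or the left end of its
  edge.\<close>

lemma matchings_on_vertex_cases:
  assumes "M \<in> matchings_on S" "v \<in> S"
  obtains "v \<in> fixed_points M" | u where "(u, v) \<in> edges M" | u where "(v, u) \<in> edges M"
proof -
  obtain B where B: "B \<in> M" "v \<in> B" "card B = 1 \<or> card B = 2"
    using assms by (auto simp: matchings_on_def partition_on_def)
  from B(3) show thesis
  proof
    assume "card B = 1"
    then have "B = {v}" using B(2) by (auto simp: card_1_singleton_iff)
    then show thesis using B(1) that(1) by (simp add: fixed_points_def)
  next
    assume "card B = 2"
    then obtain u where u: "B = {u, v}" "u \<noteq> v"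
      using B(2) by (auto simp: card_2_iff)
    then show thesis
      using B(1) that(2) [of u] that(3) [of u] linorder_less_linear [of u v]
      by (auto simp: edges_def insert_commute)
  qed
qed

section \<open>Splitting matchings by the block of a chosen vertex\<close>

lemma insert_in_matchings_on:
  assumes "M \<in> matchings_on (S - B)" "B \<subseteq> S" "card B = 1 \<or> card B = 2"
  shows "insert B M \<in> matchings_on S" "B \<notin> M"
proof -
  have "B \<noteq> {}" using assms(3) by auto
  moreover have "partition_on (S - B) M" using assms(1) by (simp add: matchings_on_def)
  moreover from this have "disjnt B (\<Union>M)" by (auto simp: partition_on_def disjnt_def)
  ultimately show "insert B M \<in> matchings_on S"
    using assms by (auto simp: matchings_on_def partition_on_insert)
  show "B \<notin> M" using assms(1) \<open>B \<noteq> {}\<close> matchings_on_subset by blast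
qed

lemma remove_in_matchings_on:
  assumes "M \<in> matchings_on S" "B \<in> M"
  shows "M - {B} \<in> matchings_on (S - B)"
proof -
  have "partition_on S M" using assms by (simp add: matchings_on_def)
  then have "disjnt B (\<Union>(M - {B}))" "partition_on S (insert B (M - {B}))"
    using assms(2) by (auto simp: partition_on_def disjoint_def disjnt_def insert_absorb)
  then show ?thesis
    using assms(1) by (simp add: matchings_on_def partition_on_insert del: insert_Diff_single)
qed

text \<open>Deleting \<open>B\<close> inverts the insertion: \<open>B\<close> is nonempty and
  disjoint from \<open>S - B\<close>, so it is never already a block of a matching of
  \<open>S - B\<close>.\<close>

lemma matchings_on_block_split:
  assumes "B \<subseteq> S" "card B = 1 \<or> card B = 2"
  shows "bij_betw (insert B) (matchings_on (S - B)) {M \<in> matchings_on S. B \<in> M}"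
proof (rule bij_betw_byWitness [where f' = "\<lambda>M. M - {B}"])
  show "\<forall>M\<in>matchings_on (S - B). insert B M - {B} = M"
    using insert_in_matchings_on(2) [OF _ assms] by auto
  show "insert B ` matchings_on (S - B) \<subseteq> {M \<in> matchings_on S. B \<in> M}"
    using insert_in_matchings_on(1) [OF _ assms] by auto
qed (auto intro: remove_in_matchings_on)

lemma matchings_on_decompose:
  assumes "m \<in> S"
  shows "matchings_on S = {M \<in> matchings_on S. {m} \<in> M}
           \<union> (\<Union>a\<in>S - {m}. {M \<in> matchings_on S. {a, m} \<in> M})"
proof (intro equalityI subsetI)
  fix M assume M: "M \<in> matchings_on S"
  from M assms have "{m} \<in> M \<or> (\<exists>a\<in>S - {m}. {a, m} \<in> M)"
  proof (cases rule: matchings_on_vertex_cases)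
    case 1
    then show ?thesis by (simp add: fixed_points_def)
  next
    case (2 u)
    then show ?thesis using edgesD [OF M 2] by (auto simp: edges_def)
  next
    case (3 u)
    then show ?thesis using edgesD [OF M 3] by (auto simp: edges_def insert_commute)
  qed
  with M show "M \<in> {M \<in> matchings_on S. {m} \<in> M}
           \<union> (\<Union>a\<in>S - {m}. {M \<in> matchings_on S. {a, m} \<in> M})" by auto
qed auto

lemma matchings_on_block_unique:
  assumes "M \<in> matchings_on S" "B \<in> M" "B' \<in> M" "m \<in> B" "m \<in> B'"
  shows "B = B'"
  using assms by (auto simp: matchings_on_def partition_on_def disjoint_def)

text \<open>Sorting matchings by the block through \<open>m\<close> and deleting that block turns
  the sum into sums over smaller vertex sets. Here \<open>m\<close> is any vertex; maximality enters
  only through the weights.\<close>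

lemma sum_matchings_on:
  fixes f :: "nat set set \<Rightarrow> 'a::comm_monoid_add"
  assumes "finite S" "m \<in> S"
  shows "(\<Sum>M\<in>matchings_on S. f M) =
           (\<Sum>M\<in>matchings_on (S - {m}). f (insert {m} M))
           + (\<Sum>a\<in>S - {m}. \<Sum>M\<in>matchings_on (S - {a, m}). f (insert {a, m} M))"
proof -
  let ?P = "\<lambda>B. {M \<in> matchings_on S. B \<in> M}"
  have fin: "finite (?P B)" for B using finite_matchings_on [OF assms(1)] by simp
  \<comment> \<open>A matching has only one block through \<open>m\<close>, so distinct choices of
    that block give disjoint families.\<close>
  have disj: "?P {m} \<inter> (\<Union>a\<in>S - {m}. ?P {a, m}) = {}"
    using matchings_on_block_unique [of _ S "{m}" _ m] by auto
  have disj': "?P {a, m} \<inter> ?P {b, m} = {}" if "a \<noteq> b" for a b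
    using matchings_on_block_unique [of _ S "{a, m}" "{b, m}" m] that
    by (auto simp: doubleton_eq_iff)
  have block: "(\<Sum>M\<in>?P B. f M) = (\<Sum>M\<in>matchings_on (S - B). f (insert B M))"
    if "B \<subseteq> S" "card B = 1 \<or> card B = 2" for B
    using sum.reindex_bij_betw [OF matchings_on_block_split [OF that], of f] by simp
  have "(\<Sum>M\<in>matchings_on S. f M)
      = (\<Sum>M\<in>?P {m}. f M) + (\<Sum>M\<in>(\<Union>a\<in>S - {m}. ?P {a, m}). f M)"
    by (subst matchings_on_decompose [OF assms(2)], subst sum.union_disjoint)
       (use assms fin disj in auto)
  also have "(\<Sum>M\<in>(\<Union>a\<in>S - {m}. ?P {a, m}). f M) = (\<Sum>a\<in>S - {m}. \<Sum>M\<in>?P {a, m}. f M)"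
    by (rule sum.UNION_disjoint) (use assms fin disj' in auto)
  also have "\<dots> = (\<Sum>a\<in>S - {m}. \<Sum>M\<in>matchings_on (S - {a, m}). f (insert {a, m} M))"
    by (rule sum.cong [OF refl], rule block) (use assms in auto)
  also have "(\<Sum>M\<in>?P {m}. f M) = (\<Sum>M\<in>matchings_on (S - {m}). f (insert {m} M))"
    by (rule block) (use assms in auto)
  finally show ?thesis .
qed

section \<open>Weights after adding the block of the largest vertex\<close>

lemma fixed_points_insert_singleton: "fixed_points (insert {m} M) = insert m (fixed_points M)"
  by (auto simp: fixed_points_def)

lemma edges_insert_singleton: "edges (insert {m} M) = edges M"
  by (auto simp: edges_def)

lemma fixed_points_insert_edge: "a < m \<Longrightarrow> fixed_points (insert {a, m} M) = fixed_points M"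
  by (auto simp: fixed_points_def)

lemma edges_insert_edge: "a < m \<Longrightarrow> edges (insert {a, m} M) = insert (a, m) (edges M)"
  by (auto simp: edges_def doubleton_eq_iff)

text \<open>Every edge of \<open>M\<close> ends before \<open>m\<close>, so none nests the new fixed
  point. The edges stay the same, so the conditions between them do too, and only the factor
  \<open>x\<close> is new.\<close>

lemma wt_insert_max_singleton:
  assumes "finite T" "M \<in> matchings_on T" "\<forall>v\<in>T. v < m"
  shows "wt x c (insert {m} M) = x * wt x c M"
proof -
  have "edge_weight c (insert {m} M) e = edge_weight c M e" if "e \<in> edges M" for e
  proof -
    have "\<not> nests_vertex e m"
      using edgesD [OF assms(2), of "fst e" "snd e"] that assms(3)
      by (auto simp: nests_vertex_def)
    then show ?thesis
      by (simp add: edge_weight_def has_left_crossing_def fixed_points_insert_singleton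
          edges_insert_singleton)
  qed
  moreover have "m \<notin> fixed_points M" using fixed_pointsD [OF assms(2)] assms(3) by blast
  ultimately show ?thesis
    using finite_fixed_points [OF assms(1,2)]
    by (simp add: wt_def fixed_points_insert_singleton edges_insert_singleton mult_ac)
qed

lemma edge_weight_max_edge:
  assumes "M \<in> matchings_on T" "\<forall>v\<in>T. v < m" "a < m" "a \<notin> T"
  shows "edge_weight c (insert {a, m} M) (a, m) = (if \<exists>v\<in>T. a < v then - 1 else - c)"
proof -
  let ?M = "insert {a, m} M"
  let ?free = "(\<forall>v\<in>fixed_points ?M. \<not> nests_vertex (a, m) v)
    \<and> (\<forall>e\<in>edges ?M. \<not> nests_edge (a, m) e) \<and> \<not> has_left_crossing ?M (a, m)"
  note defs = nests_vertex_def nests_edge_def has_left_crossing_def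
    fixed_points_insert_edge [OF assms(3)] edges_insert_edge [OF assms(3)]
  have "\<not> ?free" if v: "v \<in> T" "a < v" for v
    using assms(1) v(1)
  proof (cases rule: matchings_on_vertex_cases)
    case 1
    then show ?thesis using v assms(2) by (auto simp: defs)
  next
    case (2 u)
    have "u \<noteq> a" using edgesD [OF assms(1) 2] assms(4) by auto
    \<comment> \<open>The edge \<open>(u, v)\<close> ends between \<open>a\<close> and
      \<open>m\<close>: it is a left crossing of \<open>(a, m)\<close> if \<open>u < a\<close>, and
      nested in it if \<open>a < u\<close>.\<close>
    then consider "u < a" | "a < u" by linarith
    then show ?thesis
      using 2 v assms(2) edgesD [OF assms(1) 2] by cases (force simp: defs)+
  next
    case (3 u)
    \<comment> \<open>The partner \<open>u\<close> of \<open>v\<close> lies to the right of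
      \<open>v\<close> and, by maximality of \<open>m\<close>, before \<open>m\<close>; so
      \<open>(v, u)\<close> is nested.\<close>
    then show ?thesis using v assms(2) edgesD [OF assms(1) 3] by (force simp: defs)
  qed
  \<comment> \<open>Any violation would put a vertex of \<open>T\<close> to the right of
    \<open>a\<close>: a nested fixed point, an end of a nested edge, or the right end of a left
    crossing.\<close>
  moreover have ?free if "\<not> (\<exists>v\<in>T. a < v)"
    using that edgesD [OF assms(1)] fixed_pointsD [OF assms(1)] by (fastforce simp: defs)
  ultimately show ?thesis by (auto simp only: edge_weight_def if_True if_False split: if_splits)
qed

text \<open>Being nested in \<open>e\<close> or being a left crossing of \<open>e\<close> both
  require ending before \<open>e\<close> does. The new edge ends after every edge of
  \<open>M\<close>, so the old edges keep their weights.\<close>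

lemma wt_insert_max_edge:
  assumes "finite T" "M \<in> matchings_on T" "\<forall>v\<in>T. v < m" "a < m" "a \<notin> T"
  shows "wt x c (insert {a, m} M) = (if \<exists>v\<in>T. a < v then - 1 else - c) * wt x c M"
proof -
  have "edge_weight c (insert {a, m} M) e = edge_weight c M e" if "e \<in> edges M" for e
  proof -
    have "snd e < m"
      using edgesD [OF assms(2), of "fst e" "snd e"] that assms(3) by auto
    then show ?thesis
      by (simp add: edge_weight_def has_left_crossing_def nests_edge_def
          fixed_points_insert_edge [OF assms(4)] edges_insert_edge [OF assms(4)])
  qed
  moreover have "(a, m) \<notin> edges M" using edgesD [OF assms(2)] assms(5) by blast
  ultimately show ?thesis
    using finite_edges [OF assms(1,2)] edge_weight_max_edge [OF assms(2-5), of c]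
    by (simp add: wt_def fixed_points_insert_edge [OF assms(4)] edges_insert_edge [OF assms(4)]
        mult_ac)
qed

section \<open>Summing over the partner and the recurrence\<close>

text \<open>Only \<open>a = Max T\<close> contributes \<open>- c\<close>; each of the other
  \<open>card T - 1\<close> elements contributes \<open>- 1\<close>.\<close>

lemma sum_max_distinguished:
  fixes c :: "'a::comm_ring_1" and T :: "nat set"
  assumes "finite T" "T \<noteq> {}"
  shows "(\<Sum>a\<in>T. if \<exists>v\<in>T - {a}. a < v then - 1 else - c) = - (of_int (int (card T) - 1) + c)"
proof -
  have "(\<Sum>a\<in>T. if \<exists>v\<in>T - {a}. a < v then - 1 else - c)
      = (\<Sum>a\<in>T. if a = Max T then - c else - 1)"
  proof (rule sum.cong [OF refl])
    fix a assume "a \<in> T"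
    then have "(\<exists>v\<in>T - {a}. a < v) \<longleftrightarrow> a \<noteq> Max T"
      using assms Max_in [OF assms] Max_ge [OF assms(1)]
      by (metis Diff_iff leD le_neq_implies_less singletonD)
    then show "(if \<exists>v\<in>T - {a}. a < v then - 1 else - c) = (if a = Max T then - c else - 1)"
      by simp
  qed
  also have "\<dots> = - c + (\<Sum>a\<in>T - {Max T}. - 1)"
    using assms by (subst sum.remove [of _ "Max T"]) auto
  also have "\<dots> = - (of_int (int (card T) - 1) + c)"
    using assms by (simp add: card_Diff_singleton card_gt_0_iff of_nat_diff Suc_le_eq)
  finally show ?thesis .
qed

text \<open>Strong induction on the cardinality, with \<open>S\<close> arbitrary because deleting
  the partner of the largest vertex may leave a gap. The smaller sets have one or two elements
  fewer, matching the two terms of the recurrence.\<close>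

lemma sum_wt_matchings_on:
  fixes x c :: "'a::comm_ring_1"
  assumes "finite S"
  shows "(\<Sum>M\<in>matchings_on S. wt x c M) = assoc_hermite (int (card S)) x c"
  using assms
proof (induction "card S" arbitrary: S rule: less_induct)
  case less
  show ?case
  proof (cases "S = {}")
    case True
    then show ?thesis
      by (simp add: matchings_on_empty assoc_hermite_0 wt_def fixed_points_def edges_def)
  next
    case False
    define m where "m = Max S"
    define T where "T = S - {m}"
    have m: "m \<in> S" using less.prems False by (simp add: m_def)
    have finT: "finite T" using less.prems by (simp add: T_def)
    have lt: "v < m" if "v \<in> T" for v
      using Max_ge [OF less.prems, of v] that by (auto simp: m_def T_def)
    have cardS: "card S = card T + 1"
      using card_Suc_Diff1 [OF less.prems m] by (simp add: T_def)
    let ?h = "\<lambda>k. assoc_hermite k x c"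
    have singleton: "(\<Sum>M\<in>matchings_on T. wt x c (insert {m} M)) = x * ?h (int (card T))"
      using less.hyps [of T] finT cardS wt_insert_max_singleton [OF finT _ , of _ m x c] lt
      by (simp add: sum_distrib_left [symmetric])
    have edge: "(\<Sum>M\<in>matchings_on (S - {a, m}). wt x c (insert {a, m} M))
        = (if \<exists>v\<in>T - {a}. a < v then - 1 else - c) * ?h (int (card T) - 1)" if a: "a \<in> T" for a
    proof -
      have eq: "S - {a, m} = T - {a}" by (auto simp: T_def)
      have card: "card (T - {a}) < card S" "int (card (T - {a})) = int (card T) - 1"
        using card_Suc_Diff1 [OF finT a] cardS by linarith+
      have "(\<Sum>M\<in>matchings_on (T - {a}). wt x c (insert {a, m} M))
          = (\<Sum>M\<in>matchings_on (T - {a}). (if \<exists>v\<in>T - {a}. a < v then - 1 else - c) * wt x c M)"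
        by (rule sum.cong [OF refl], rule wt_insert_max_edge) (use finT lt a in auto)
      also have "\<dots> = (if \<exists>v\<in>T - {a}. a < v then - 1 else - c) * ?h (int (card T) - 1)"
        using less.hyps [OF card(1)] finT card(2) by (simp only: sum_distrib_left [symmetric]) simp
      finally show ?thesis by (simp only: eq)
    qed
    have "(\<Sum>M\<in>matchings_on S. wt x c M) = x * ?h (int (card T))
        + (\<Sum>a\<in>T. if \<exists>v\<in>T - {a}. a < v then - 1 else - c) * ?h (int (card T) - 1)"
      using sum_matchings_on [OF less.prems m, of "wt x c"] singleton edge
      by (simp add: T_def [symmetric] sum_distrib_right)
    also have "\<dots> = x * ?h (int (card T)) - (of_int (int (card T) - 1) + c) * ?h (int (card T) - 1)"
    \<comment> \<open>For empty \<open>T\<close> the sum over partners is \<open>0\<close>, which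
      differs in general from the closed form; both sides still agree because the other factor is
      \<open>assoc_hermite (- 1) x c = 0\<close>.\<close>
    proof (cases "T = {}")
      case True
      then show ?thesis by (simp add: assoc_hermite_neg)
    next
      case False
      show ?thesis by (simp only: sum_max_distinguished [OF finT False]) (simp add: algebra_simps)
    qed
    also have "\<dots> = ?h (int (card S))"
      using assoc_hermite_rec [of "int (card T)" x c] cardS by (simp add: add.commute)
    finally show ?thesis .
  qed
qed

theorem mainTheorem1:
  fixes n :: nat
  shows "assoc_hermite (int n) indet_x (indet_c :: 'a::comm_ring_1 poly poly) =
         (\<Sum>M\<in>incomplete_matchings n. wt indet_x indet_c M)"
  \<comment> \<open>The identity holds for any two elements of any commutative ring; it is
    specialised to the indeterminates of the iterated polynomial ring.\<close>
  using sum_wt_matchings_on [of "{1..n}", symmetric]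
  by (simp add: matchings_on_atLeastAtMost del: One_nat_def)

end
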